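(* Consider the continuous-time Markov process $(W(t),\xi(t))$ on $\mathcal W_p\times\{0,1\}^{\mathcal X}$ described in the context, with arbitrary initial condition. Assume: 1. $\sum_{x\in D}\alpha_x\le\sum_{y\in N(D)}\beta_y$ for every $D\subseteq\mathcal X$; 2. $\nu^{on}_x>0$ and $\nu^{act}_x>0$ for every $x\in\mathcal X$; 3. $\{\mathcal M_{\bar x}(W,\xi)\}$ is an admissible family. Then $$\mathbb P\big(\exists\, t_0\ :\ W(t)\in\mathcal W\ \ \forall t\ge t_0\big)=1 .$$
   Context: **Model.** $\mathcal G=(\mathcal X,\mathcal E)$ is a finite directed graph; $N_x=\{y:(x,y)\in\mathcal E\}$, $N(D)=\bigcup_{x\in D}N_x$. $\alpha,\beta$ are vectors of nonnegative integers indexed by $\mathcal X$. A partial allocation state is a matrix $W\in\mathbb N^{\mathcal X\times\mathcal X}$ (nonnegative integer entries) with $W_{xy}=0$ if $(x,y)\notin\mathcal E$; $W^x:=\sum_yW_{xy}\le\alpha_x$ for all $x$; $W_y:=\sum_xW_{xy}\le\beta_y$ for all $y$. $\mathcal W_p$ is the set of these, and $\mathcal W=\{W\in\mathcal W_p: W^x=\alpha_x\ \forall x\}$ is the set of allocation states. $\|W\|=\sum_{x,y}W_{xy}$. **Admissible families.** A functional state is $\xi\in\{0,1\}^{\mathcal X}$. $e_{xy}$ is the matrix with $1$ in position $(x,y)$ and $0$ elsewhere. For $W\in\mathcal W_p$, $\xi$, and $\bar x$ with $\xi_{\bar x}=1$, let $$\mathcal W_{\bar x}(W,\xi)=\{W'\in\mathcal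 W_p: W'\ne W,\ W'^{\bar x}\ge W^{\bar x},\ W'_{xy}=W_{xy}\text{ whenever }x\ne\bar x\text{ or }\xi_y=0\},$$ $$N_{\bar x}(W,\xi)=\{y\in N_{\bar x}: W_y<\beta_y,\ \xi_y=1\}.$$ A family of subsets $\mathcal M_{\bar x}(W,\xi)\subseteq\mathcal W_{\bar x}(W,\xi)$ (for all $W\in\mathcal W_p$, $\xi$, and $\bar x$ with $\xi_{\bar x}=1$) is admissible if: (i) if $W^{\bar x}<\alpha_{\bar x}$ and $y\in N_{\bar x}(W,\xi)$, then there is an integer $n\ge1$ with $W+n e_{\bar xy}\in\mathcal M_{\bar x}(W,\xi)$; (ii) if $W_{\bar xy'}>0$, $\xi_{y'}=1$, $y''\in N_{\bar x}(W,\xi)$ and $y''\neq y'$, then $W+e_{\bar xy''}-e_{\bar xy'}\in\mathcal M_{\bar x}(W,\xi)$; (iii) for all $W,W'\in\mathcal W$: $W'\in\mathcal M_{\bar x}(W,\xi)$ iff $W\in\mathcal M_{\bar x}(W',\xi)$. **Potential and utilities.** $\Psi:\mathcal W_p\to\mathbb R$ has the form $\Psi(W)=\sum_xf_x(W_{x\cdot})+\sum_yg_y(W_{\cdot y})$, with $f_x,g_y$ real-valued functions of the $x$-th row and $y$-th column of $W$. The utilities $U_x:\mathcal W_p\to\mathbb R$ satisfy $U_{\bar x}(W')-U_{\bar x}(W)=\Psi(W')-\Psi(W)$ whenever $W,W'\in\mathcal W_p$ agree outside row $\bar x$ (for instance $U_x(W)=f_x(W_{x\cdot})+\sum_{y\in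 N_x}g_y(W_{\cdot y})$). **Process.** Fix $\gamma>0$ and rates $\nu_x^{on},\nu_x^{off},\nu_x^{act}\ge0$. Let $Z^{(W,\xi)}_{\bar x}=\sum_{\tilde W\in\mathcal M_{\bar x}(W,\xi)}e^{\gamma U_{\bar x}(\tilde W)}$ and $Z^{(W,W',\xi)}_{\bar x}=\max\{Z^{(W,\xi)}_{\bar x},Z^{(W',\xi)}_{\bar x}\}$. For $W'\in\mathcal M_{\bar x}(W,\xi)$ set $P^{(W,\xi)}_{\bar x}(W')=e^{\gamma U_{\bar x}(W')}/Z^{(W,\xi)}_{\bar x}$ if $\|W\|<\|W'\|$, and $P^{(W,\xi)}_{\bar x}(W')=e^{\gamma U_{\bar x}(W')}/Z^{(W,W',\xi)}_{\bar x}$ if $\|W\|=\|W'\|$ (the remaining probability is assigned to staying at $W$). $(W(t),\xi(t))$ is the continuous-time Markov chain on $\mathcal W_p\times\{0,1\}^{\mathcal X}$ whose only nonzero transition rates between distinct states are: from $(W,\xi)$ to $(W,\xi')$, where $\xi'$ differs from $\xi$ only at $\bar x$: rate $\nu^{on}_{\bar x}$ if $\xi_{\bar x}=0,\xi'_{\bar x}=1$, and rate $\nu^{off}_{\bar x}$ if $\xi_{\bar x}=1,\xi'_{\bar x}=0$; from $(W,\xi)$ to $(W',\xi)$, where $\xi_{\bar x}=1$ and $W'\in\mathcal M_{\bar x}(W,\xi)$: rate $\nu^{act}_{\bar x}P^{(W,\xi)}_{\bar x}(W')$. *)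

theory Defs
  imports "HOL-Probability.Probability"
begin

section \<open>Allocation states\<close>

text \<open>
  The vertex set of the graph is the universe of a finite type \<open>'x\<close>, the edges form an arbitrary
  relation \<open>E\<close> (loops are allowed).  The neighbourhood of a vertex \<open>x\<close> is \<open>E `` {x}\<close> and that of a
  set \<open>D\<close> of vertices is \<open>E `` D\<close>.
\<close>

type_synonym 'x alloc = "'x \<Rightarrow> 'x \<Rightarrow> nat"

type_synonym 'x func = "'x \<Rightarrow> bool"

definition row_sum :: "('x::finite) alloc \<Rightarrow> 'x \<Rightarrow> nat" where
  "row_sum W x = (\<Sum>y\<in>UNIV. W x y)"

definition col_sum :: "('x::finite) alloc \<Rightarrow> 'x \<Rightarrow> nat" where
  "col_sum W y = (\<Sum>x\<in>UNIV. W x y)"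

definition total :: "('x::finite) alloc \<Rightarrow> nat" where
  "total W = (\<Sum>x\<in>UNIV. \<Sum>y\<in>UNIV. W x y)"

definition partial_allocs :: "('x::finite) rel \<Rightarrow> ('x \<Rightarrow> nat) \<Rightarrow> ('x \<Rightarrow> nat) \<Rightarrow> 'x alloc set" where
  "partial_allocs E \<alpha> \<beta> =
     {W. (\<forall>x y. (x, y) \<notin> E \<longrightarrow> W x y = 0) \<and> (\<forall>x. row_sum W x \<le> \<alpha> x) \<and> (\<forall>y. col_sum W y \<le> \<beta> y)}"

definition allocs :: "('x::finite) rel \<Rightarrow> ('x \<Rightarrow> nat) \<Rightarrow> ('x \<Rightarrow> nat) \<Rightarrow> 'x alloc set" where
  "allocs E \<alpha> \<beta> = {W \<in> partial_allocs E \<alpha> \<beta>. \<forall>x. row_sum W x = \<alpha> x}"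

definition unit_alloc :: "'x \<Rightarrow> 'x \<Rightarrow> 'x alloc" where
  "unit_alloc a b = (\<lambda>x y. if x = a \<and> y = b then 1 else 0)"

section \<open>Admissible families\<close>

definition available_moves ::
  "('x::finite) rel \<Rightarrow> ('x \<Rightarrow> nat) \<Rightarrow> ('x \<Rightarrow> nat) \<Rightarrow> 'x \<Rightarrow> 'x alloc \<Rightarrow> 'x func \<Rightarrow> 'x alloc set" where
  "available_moves E \<alpha> \<beta> a W \<xi> =
     {W' \<in> partial_allocs E \<alpha> \<beta>. W' \<noteq> W \<and> row_sum W' a \<ge> row_sum W a \<and>
        (\<forall>x y. x \<noteq> a \<or> \<not> \<xi> y \<longrightarrow> W' x y = W x y)}"

definition available_nbrs ::
  "('x::finite) rel \<Rightarrow> ('x \<Rightarrow> nat) \<Rightarrow> 'x \<Rightarrow> 'x alloc \<Rightarrow> 'x func \<Rightarrow> 'x set" where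
  "available_nbrs E \<beta> a W \<xi> = {y \<in> E `` {a}. col_sum W y < \<beta> y \<and> \<xi> y}"

text \<open>
  The subtraction of natural numbers in the second condition does not truncate, since
  \<open>W a y' > 0\<close>.
\<close>

definition admissible_family ::
  "('x::finite) rel \<Rightarrow> ('x \<Rightarrow> nat) \<Rightarrow> ('x \<Rightarrow> nat) \<Rightarrow>
   ('x \<Rightarrow> 'x alloc \<Rightarrow> 'x func \<Rightarrow> 'x alloc set) \<Rightarrow> bool" where
  "admissible_family E \<alpha> \<beta> \<M> \<longleftrightarrow>
     (\<forall>a \<xi>. \<xi> a \<longrightarrow>
        (\<forall>W \<in> partial_allocs E \<alpha> \<beta>.
           \<M> a W \<xi> \<subseteq> available_moves E \<alpha> \<beta> a W \<xi> \<and>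
           (\<forall>y \<in> available_nbrs E \<beta> a W \<xi>. row_sum W a < \<alpha> a \<longrightarrow>
              (\<exists>n\<ge>1. (\<lambda>u v. W u v + n * unit_alloc a y u v) \<in> \<M> a W \<xi>)) \<and>
           (\<forall>y'. \<forall>y'' \<in> available_nbrs E \<beta> a W \<xi>. W a y' > 0 \<and> \<xi> y' \<and> y'' \<noteq> y' \<longrightarrow>
              (\<lambda>u v. W u v + unit_alloc a y'' u v - unit_alloc a y' u v) \<in> \<M> a W \<xi>)) \<and>
        (\<forall>W \<in> allocs E \<alpha> \<beta>. \<forall>W' \<in> allocs E \<alpha> \<beta>. W' \<in> \<M> a W \<xi> \<longleftrightarrow> W \<in> \<M> a W' \<xi>))"

section \<open>Transition rates of the allocation dynamics\<close>

definition partition_sum ::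
  "real \<Rightarrow> ('x \<Rightarrow> 'x alloc \<Rightarrow> real) \<Rightarrow> ('x \<Rightarrow> 'x alloc \<Rightarrow> 'x func \<Rightarrow> 'x alloc set) \<Rightarrow>
   'x \<Rightarrow> 'x alloc \<Rightarrow> 'x func \<Rightarrow> real" where
  "partition_sum \<gamma> U \<M> a W \<xi> = (\<Sum>V \<in> \<M> a W \<xi>. exp (\<gamma> * U a V))"

text \<open>
  Only the values at \<open>W' \<in> \<M> a W \<xi>\<close> matter; for an admissible family the total of such a \<open>W'\<close> is at
  least that of \<open>W\<close>, so the last branch is never reached there.
\<close>

definition move_prob ::
  "real \<Rightarrow> ('x \<Rightarrow> 'x alloc \<Rightarrow> real) \<Rightarrow> ('x \<Rightarrow> 'x alloc \<Rightarrow> 'x func \<Rightarrow> 'x alloc set) \<Rightarrow>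
   'x::finite \<Rightarrow> 'x alloc \<Rightarrow> 'x func \<Rightarrow> 'x alloc \<Rightarrow> real" where
  "move_prob \<gamma> U \<M> a W \<xi> W' =
     (if total W < total W' then exp (\<gamma> * U a W') / partition_sum \<gamma> U \<M> a W \<xi>
      else if total W = total W' then
        exp (\<gamma> * U a W') / max (partition_sum \<gamma> U \<M> a W \<xi>) (partition_sum \<gamma> U \<M> a W' \<xi>)
      else 0)"

text \<open>
  Rates between distinct states.  Each of the two sums has at most one term: the vertex \<open>a\<close> is
  determined by the pair of states, because \<open>\<xi>'\<close> differs from \<open>\<xi>\<close> exactly at \<open>a\<close>, respectively
  because \<open>W' \<noteq> W\<close> differ only in row \<open>a\<close>.
\<close>

fun alloc_rate ::
  "real \<Rightarrow> ('x \<Rightarrow> 'x alloc \<Rightarrow> real) \<Rightarrow> ('x \<Rightarrow> 'x alloc \<Rightarrow> 'x func \<Rightarrow> 'x alloc set) \<Rightarrow>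
   ('x \<Rightarrow> real) \<Rightarrow> ('x \<Rightarrow> real) \<Rightarrow> ('x \<Rightarrow> real) \<Rightarrow>
   ('x::finite) alloc \<times> 'x func \<Rightarrow> 'x alloc \<times> 'x func \<Rightarrow> real" where
  "alloc_rate \<gamma> U \<M> \<nu>on \<nu>off \<nu>act (W, \<xi>) (W', \<xi>') =
     (if W' = W then \<Sum>a | \<xi>' = \<xi>(a := \<not> \<xi> a). (if \<xi> a then \<nu>off a else \<nu>on a)
      else if \<xi>' = \<xi> then \<Sum>a | \<xi> a \<and> W' \<in> \<M> a W \<xi>. \<nu>act a * move_prob \<gamma> U \<M> a W \<xi> W'
      else 0)"

section \<open>Continuous-time Markov chains on a finite state space\<close>

text \<open>
  \<open>p t i j\<close> is the probability of going from \<open>i\<close> to \<open>j\<close> in time \<open>t\<close>.  The rates \<open>q i j\<close> are only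
  used for \<open>i \<noteq> j\<close>: as \<open>S\<close> is finite and the rows of \<open>p t\<close> sum to 1, the right derivatives at 0 of
  the diagonal entries are then determined, and \<open>p\<close> is the semigroup generated by \<open>q\<close>.
\<close>

definition transition_semigroup ::
  "'s set \<Rightarrow> ('s \<Rightarrow> 's \<Rightarrow> real) \<Rightarrow> (real \<Rightarrow> 's \<Rightarrow> 's \<Rightarrow> real) \<Rightarrow> bool" where
  "transition_semigroup S q p \<longleftrightarrow>
     (\<forall>t\<ge>0. \<forall>i\<in>S. (\<forall>j\<in>S. 0 \<le> p t i j) \<and> (\<Sum>j\<in>S. p t i j) = 1) \<and>
     (\<forall>i\<in>S. \<forall>j\<in>S. p 0 i j = (if i = j then 1 else 0)) \<and>
     (\<forall>s\<ge>0. \<forall>t\<ge>0. \<forall>i\<in>S. \<forall>j\<in>S. p (s + t) i j = (\<Sum>k\<in>S. p s i k * p t k j)) \<and>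
     (\<forall>i\<in>S. \<forall>j\<in>S. i \<noteq> j \<longrightarrow> ((\<lambda>h. p h i j / h) \<longlongrightarrow> q i j) (at_right 0))"

text \<open>
  Time is the half-line of nonnegative reals; \<open>X t\<close> is unconstrained for negative \<open>t\<close>.  Right
  continuity of the paths refers to the discrete topology on \<open>S\<close>.  The law of \<open>X 0\<close> is arbitrary.
\<close>

locale ctmc = prob_space M
  for M :: "'w measure" and S :: "'s set" and q :: "'s \<Rightarrow> 's \<Rightarrow> real"
    and X :: "real \<Rightarrow> 'w \<Rightarrow> 's" +
  assumes finite_states: "finite S"
    and measurable_X: "\<And>t. t \<ge> 0 \<Longrightarrow> X t \<in> measurable M (count_space S)"
    and right_continuous:
      "\<And>\<omega> t. \<omega> \<in> space M \<Longrightarrow> t \<ge> 0 \<Longrightarrow> eventually (\<lambda>s. X s \<omega> = X t \<omega>) (at_right t)"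
    and markov:
      "\<exists>p. transition_semigroup S q p \<and>
        (\<forall>(n::nat) (t :: nat \<Rightarrow> real) (i :: nat \<Rightarrow> 's).
           0 \<le> t 0 \<and> (\<forall>k\<le>n. t k < t (Suc k)) \<and> (\<forall>k\<le>Suc n. i k \<in> S) \<and>
           \<P>(\<omega> in M. \<forall>k\<le>n. X (t k) \<omega> = i k) > 0 \<longrightarrow>
           \<P>(\<omega> in M. X (t (Suc n)) \<omega> = i (Suc n) \<bar> \<forall>k\<le>n. X (t k) \<omega> = i k)
             = p (t (Suc n) - t n) (i n) (i (Suc n)))"

end

theory Submission
  imports Defs
begin

text \<open>
  Row sums never decrease, so the set of allocation states is closed for the dynamics.  It can be
  reached from everywhere: switch all vertices on and take a vertex \<open>x\<close> with row sum below \<open>\<alpha> x\<close>.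
  By Hall's condition a walk alternating between edges and positive entries leads from \<open>x\<close> to an
  unsaturated column.  If the walk has minimal length, letting its last vertex exchange one unit
  leaves the other rows on it untouched and shortens it by one, until \<open>x\<close> itself can add a unit.
  Hence in some fixed time the finite chain enters the closed set with probability bounded away
  from 0, so it is absorbed almost surely.
\<close>

section \<open>Absorption of finite Markov chains\<close>

lemma transition_semigroup_nonneg:
  "transition_semigroup S q p \<Longrightarrow> t \<ge> 0 \<Longrightarrow> i \<in> S \<Longrightarrow> j \<in> S \<Longrightarrow> 0 \<le> p t i j"
  by (simp add: transition_semigroup_def)

lemma transition_semigroup_row_sum:
  "transition_semigroup S q p \<Longrightarrow> t \<ge> 0 \<Longrightarrow> i \<in> S \<Longrightarrow> (\<Sum>j\<in>S. p t i j) = 1"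
  by (simp add: transition_semigroup_def)

lemma transition_semigroup_0:
  "transition_semigroup S q p \<Longrightarrow> i \<in> S \<Longrightarrow> j \<in> S \<Longrightarrow> p 0 i j = (if i = j then 1 else 0)"
  by (simp add: transition_semigroup_def)

lemma transition_semigroup_Chapman_Kolmogorov:
  "transition_semigroup S q p \<Longrightarrow> s \<ge> 0 \<Longrightarrow> t \<ge> 0 \<Longrightarrow> i \<in> S \<Longrightarrow> j \<in> S \<Longrightarrow>
    p (s + t) i j = (\<Sum>k\<in>S. p s i k * p t k j)"
  by (simp add: transition_semigroup_def)

lemma transition_semigroup_rate:
  "transition_semigroup S q p \<Longrightarrow> i \<in> S \<Longrightarrow> j \<in> S \<Longrightarrow> i \<noteq> j \<Longrightarrow>
    ((\<lambda>h. p h i j / h) \<longlongrightarrow> q i j) (at_right 0)"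
  by (simp add: transition_semigroup_def)

text \<open>The mass outside \<open>A\<close> grows during a time \<open>h\<close> by at most the
  leakage \<open>m h\<close>, and \<open>m h / h\<close> tends to 0 because all rates out of
  \<open>A\<close> vanish. Cutting \<open>[0, t]\<close> into equal pieces and refining shows that
  no mass leaks. Only the derivatives at time 0 enter, so no differential equation at positive times
  is involved.\<close>

lemma semigroup_stays_in_closed_set:
  assumes p: "transition_semigroup S q p" and S: "finite S" and A: "A \<subseteq> S"
    and closed: "\<And>i j. i \<in> A \<Longrightarrow> j \<in> S - A \<Longrightarrow> q i j = 0"
    and t: "t \<ge> 0" and i: "i \<in> A" and j: "j \<in> S - A"
  shows "p t i j = 0"
proof (cases "t = 0")
  case True
  then show ?thesis using transition_semigroup_0[OF p, of i j] i j A by auto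
next
  case False
  with t have t: "t > 0" by simp
  note nonneg = transition_semigroup_nonneg[OF p]
  note row = transition_semigroup_row_sum[OF p]
  note CK = transition_semigroup_Chapman_Kolmogorov[OF p]
  have fin: "finite A" "finite (S - A)" using S A finite_subset by auto
  have le1: "p s k l \<le> 1" if "s \<ge> 0" "k \<in> S" "l \<in> S" for s k l
  proof -
    have "p s k l \<le> (\<Sum>l\<in>S. p s k l)"
      by (rule member_le_sum) (use that S nonneg in auto)
    with row that show ?thesis by simp
  qed
  define m where "m h = (\<Sum>k\<in>A. \<Sum>l\<in>S-A. p h k l)" for h
  define u where "u s = (\<Sum>l\<in>S-A. p s i l)" for s
  have "((\<lambda>h. \<Sum>k\<in>A. \<Sum>l\<in>S-A. p h k l / h) \<longlongrightarrow> (\<Sum>k\<in>A. \<Sum>l\<in>S-A. q k l)) (at_right 0)"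
    by (intro tendsto_sum) (rule transition_semigroup_rate[OF p]; use A in auto)
  then have lim: "((\<lambda>h. m h / h) \<longlongrightarrow> 0) (at_right 0)"
    using closed by (simp add: m_def sum_divide_distrib)
  have step: "u (s + h) \<le> u s + m h" if "s \<ge> 0" "h \<ge> 0" for s h
  proof -
    have iS: "i \<in> S" using i A by auto
    have "u (s + h) = (\<Sum>k\<in>S. p s i k * (\<Sum>l\<in>S-A. p h k l))"
      unfolding u_def using that iS
      by (simp add: CK sum_distrib_left) (rule sum.swap)
    also have "\<dots> = (\<Sum>k\<in>S-A. p s i k * (\<Sum>l\<in>S-A. p h k l)) + (\<Sum>k\<in>A. p s i k * (\<Sum>l\<in>S-A. p h k l))"
      by (rule sum.subset_diff) (use A S in auto)
    \<comment> \<open>Mass already outside is counted as if it never returned; each state of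
      \<open>A\<close> gets the crude weight 1.\<close>
    also have "\<dots> \<le> (\<Sum>k\<in>S-A. p s i k * 1) + (\<Sum>k\<in>A. 1 * (\<Sum>l\<in>S-A. p h k l))"
    proof (intro add_mono sum_mono mult_left_mono mult_right_mono)
      fix k assume k: "k \<in> S - A"
      have "(\<Sum>l\<in>S-A. p h k l) \<le> (\<Sum>l\<in>S. p h k l)"
        by (rule sum_mono2) (use S nonneg[OF \<open>h \<ge> 0\<close>] k in auto)
      then show "(\<Sum>l\<in>S-A. p h k l) \<le> 1" using row that k by simp
    qed (use nonneg le1 that iS A in \<open>auto intro!: sum_nonneg\<close>)
    finally show ?thesis by (simp add: u_def m_def)
  qed
  have iter: "u (real n * h) \<le> real n * m h" if "h \<ge> 0" for n h
  proof (induction n)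
    case 0
    have "u 0 = 0"
      unfolding u_def using i A
      by (intro sum.neutral) (auto simp: transition_semigroup_0[OF p])
    then show ?case by simp
  next
    case (Suc n)
    have "u (real n * h + h) \<le> u (real n * h) + m h" using step that by simp
    with Suc show ?case by (simp add: algebra_simps)
  qed
  \<comment> \<open>\<open>Suc n\<close> pieces keep the step length strictly positive, as the
    one-sided limit at 0 demands.\<close>
  have seq: "filterlim (\<lambda>n. t / real (Suc n)) (at_right 0) sequentially"
    unfolding filterlim_at using t
    by (auto intro!: LIMSEQ_Suc[OF lim_const_over_n] simp del: of_nat_Suc)
  have "(\<lambda>n. t * (m (t / real (Suc n)) / (t / real (Suc n)))) \<longlonglongrightarrow> t * 0"
    by (intro tendsto_mult tendsto_const filterlim_compose[OF lim seq])
  moreover have "u t \<le> t * (m (t / real (Suc n)) / (t / real (Suc n)))" for n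
    using iter[of "t / real (Suc n)" "Suc n"] t by (simp add: field_simps del: of_nat_Suc)
  ultimately have "u t \<le> t * 0"
    by (intro LIMSEQ_le_const) auto
  moreover have "p t i j \<le> u t"
    unfolding u_def by (rule member_le_sum) (use i j t A fin nonneg in auto)
  ultimately show ?thesis
    using nonneg[of t i j] i j A t by (simp add: subset_iff)
qed

text \<open>Off the diagonal, a positive limit of \<open>p h i j / h\<close> forces positivity for
  small \<open>h\<close>. On the diagonal, the rest of the row tends to 0 while the row sums to 1.
  Finiteness of \<open>S\<close> lets one small \<open>h\<close> serve all pairs.\<close>

lemma semigroup_eventually_positive:
  assumes p: "transition_semigroup S q p" and S: "finite S"
  shows "\<forall>\<^sub>F h in at_right 0. \<forall>i\<in>S. \<forall>j\<in>S. i = j \<or> q i j > 0 \<longrightarrow> p h i j > 0"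
proof (intro eventually_ball_finite S ballI)
  fix i j assume ij: "i \<in> S" "j \<in> S"
  note row = transition_semigroup_row_sum[OF p]
  note der = transition_semigroup_rate[OF p]
  show "\<forall>\<^sub>F h in at_right 0. i = j \<or> q i j > 0 \<longrightarrow> p h i j > 0"
  proof (cases "i = j")
    case True
    \<comment> \<open>Writing \<open>p h i l\<close> as \<open>h * (p h i l / h)\<close> turns the
      existence of the rate into convergence to 0.\<close>
    have "((\<lambda>h. h * (p h i l / h)) \<longlongrightarrow> 0 * q i l) (at_right 0)" if "l \<in> S - {i}" for l
      using that ij by (intro tendsto_mult der tendsto_ident_at) auto
    then have "((\<lambda>h. \<Sum>l\<in>S-{i}. h * (p h i l / h)) \<longlongrightarrow> (\<Sum>l\<in>S-{i}. 0 * q i l)) (at_right 0)"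
      by (intro tendsto_sum)
    then have "((\<lambda>h. \<Sum>l\<in>S-{i}. h * (p h i l / h)) \<longlongrightarrow> 0) (at_right 0)" by simp
    then have "\<forall>\<^sub>F h in at_right 0. (\<Sum>l\<in>S-{i}. h * (p h i l / h)) < 1"
      by (rule order_tendstoD) simp
    moreover have "\<forall>\<^sub>F h in at_right (0::real). h > 0"
      by (simp add: eventually_at_right_less)
    ultimately show ?thesis
    proof eventually_elim
      case (elim h)
      then have "(\<Sum>l\<in>S-{i}. p h i l) < 1" by simp
      moreover have "(\<Sum>l\<in>S. p h i l) = p h i i + (\<Sum>l\<in>S-{i}. p h i l)"
        by (rule sum.remove[OF S ij(1)])
      moreover have "(\<Sum>l\<in>S. p h i l) = 1" using row elim ij by simp
      ultimately show ?case using True by simp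
    qed
  next
    case False
    show ?thesis
    proof (cases "q i j > 0")
      case True
      have "\<forall>\<^sub>F h in at_right 0. p h i j / h > 0"
        using der[OF ij False] True by (rule order_tendstoD)
      moreover have "\<forall>\<^sub>F h in at_right (0::real). h > 0"
        by (simp add: eventually_at_right_less)
      ultimately show ?thesis
        by eventually_elim (simp add: zero_less_divide_iff)
    qed (use False in simp)
  qed
qed

text \<open>Every state has positive probability to be in \<open>A\<close> at the common time
  \<open>T\<close>, so by finiteness the probability of being outside is at most some
  \<open>r < 1\<close>. Since \<open>A\<close> is never left, being outside at time
  \<open>(n + 1) * T\<close> requires being outside at time \<open>n * T\<close>, and the bounds
  multiply.\<close>

lemma semigroup_geometric_absorption:
  assumes p: "transition_semigroup S q p" and S: "finite S" and A: "A \<subseteq> S"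
    and closed: "\<And>i j. i \<in> A \<Longrightarrow> j \<in> S - A \<Longrightarrow> q i j = 0"
    and reach: "\<And>i. i \<in> S \<Longrightarrow> \<exists>j\<in>A. (i, j) \<in> {(i, j). i \<in> S \<and> j \<in> S \<and> q i j > 0}\<^sup>*"
  obtains T r where "T > 0" "0 \<le> r" "r < 1"
    "\<And>n i. i \<in> S \<Longrightarrow> (\<Sum>j\<in>S-A. p (real n * T) i j) \<le> r ^ n"
proof -
  note nonneg = transition_semigroup_nonneg[OF p]
  note row = transition_semigroup_row_sum[OF p]
  note CK = transition_semigroup_Chapman_Kolmogorov[OF p]
  note p0 = transition_semigroup_0[OF p]
  \<comment> \<open>One positive term in the Chapman-Kolmogorov sum suffices.\<close>
  have pos: "p (s + h) k l > 0"
    if "s \<ge> 0" "h \<ge> 0" "k \<in> S" "l \<in> S" "m \<in> S" "p s k m > 0" "p h m l > 0" for s h k l m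
    unfolding CK[OF that(1-4)]
    by (rule sum_pos2[OF S that(5)]) (use that nonneg in auto)
  have "\<forall>\<^sub>F h in at_right (0::real). h > 0"
    by (simp add: eventually_at_right_less)
  with semigroup_eventually_positive[OF p S]
  have "\<forall>\<^sub>F h in at_right 0. h > 0 \<and> (\<forall>i\<in>S. \<forall>j\<in>S. i = j \<or> q i j > 0 \<longrightarrow> p h i j > 0)"
    by eventually_elim blast
  then obtain h where h: "h > 0" and
    hpos: "\<And>i j. i \<in> S \<Longrightarrow> j \<in> S \<Longrightarrow> i = j \<or> q i j > 0 \<Longrightarrow> p h i j > 0"
    using eventually_happens'[OF trivial_limit_at_right_real] by blast
  have path: "\<exists>n. p (real n * h) i j > 0"
    if "(i, j) \<in> {(i, j). i \<in> S \<and> j \<in> S \<and> q i j > 0}\<^sup>*" "i \<in> S" for i j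
    using that
  proof (induction rule: rtrancl_induct)
    case base
    then show ?case by (intro exI[of _ 0]) (simp add: p0)
  next
    case (step j k)
    then obtain n where "p (real n * h) i j > 0" by blast
    with step h have "p (real n * h + h) i k > 0"
      by (intro pos[of _ _ _ _ j]) (auto intro: hpos)
    then show ?case by (intro exI[of _ "Suc n"]) (simp add: algebra_simps)
  qed
  have "\<forall>i\<in>S. \<exists>n. \<exists>j\<in>A. p (real n * h) i j > 0"
    using reach path by blast
  then obtain n where n: "\<And>i. i \<in> S \<Longrightarrow> \<exists>j\<in>A. p (real (n i) * h) i j > 0"
    by metis
  \<comment> \<open>The sum dominates every \<open>n i\<close>; the successor makes \<open>T\<close>
    positive even if all \<open>n i\<close> are 0.\<close>
  define N where "N = Suc (\<Sum>i\<in>S. n i)"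
  define T where "T = real N * h"
  have T: "T > 0" using h by (simp add: T_def N_def del: of_nat_Suc)
  \<comment> \<open>Paths of different lengths are padded to a common one by waiting in the target,
    as \<open>p h j j > 0\<close>.\<close>
  have wait: "p (real (m + k) * h) i j > 0" if "p (real m * h) i j > 0" "i \<in> S" "j \<in> S" for m k i j
  proof (induction k)
    case (Suc k)
    have "p (real (m + k) * h + h) i j > 0"
      by (rule pos[OF _ _ _ _ _ Suc]) (use that hpos h in auto)
    then show ?case by (simp add: algebra_simps)
  qed (use that in simp)
  define c where "c t i = (\<Sum>j\<in>S-A. p t i j)" for t i
  have c1: "c T i < 1" if i: "i \<in> S" for i
  proof -
    obtain j where j: "j \<in> A" "p (real (n i) * h) i j > 0" using n i by blast
    have "n i \<le> N" using member_le_sum[of i S n] S i by (simp add: N_def)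
    then have "p T i j > 0"
      using wait[OF j(2) i, of "N - n i"] j A unfolding T_def by auto
    moreover have "p T i j \<le> (\<Sum>j\<in>A. p T i j)"
      by (rule member_le_sum) (use j i T A S finite_subset nonneg in auto)
    moreover have "(\<Sum>j\<in>S. p T i j) = c T i + (\<Sum>j\<in>A. p T i j)"
      unfolding c_def by (rule sum.subset_diff) (use A S in auto)
    ultimately show ?thesis using row[of T i] T i by simp
  qed
  \<comment> \<open>Inserting 0 makes the maximum meaningful for every \<open>S\<close> and yields
    \<open>0 \<le> r\<close>.\<close>
  define r where "r = Max (insert 0 (c T ` S))"
  have r: "0 \<le> r" "r < 1" "\<And>i. i \<in> S \<Longrightarrow> c T i \<le> r"
    using S c1 by (auto simp: r_def)
  have "c (real n * T) i \<le> r ^ n" if i: "i \<in> S" for n i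
  proof (induction n)
    case 0
    have "c 0 i \<le> (\<Sum>l\<in>S. p 0 i l)"
      unfolding c_def by (rule sum_mono2) (use S nonneg i in auto)
    then show ?case using row[of 0 i] i by simp
  next
    case (Suc n)
    have nT: "real n * T \<ge> 0" using T by simp
    have "c (real n * T + T) i = (\<Sum>k\<in>S. p (real n * T) i k * c T k)"
      unfolding c_def using nT T i
      by (simp add: CK sum_distrib_left) (rule sum.swap)
    \<comment> \<open>Intermediate states in \<open>A\<close> drop out: from there the outside has
      probability 0.\<close>
    also have "\<dots> = (\<Sum>k\<in>S-A. p (real n * T) i k * c T k)"
    proof (rule sum.mono_neutral_right[OF S])
      show "\<forall>k\<in>S - (S - A). p (real n * T) i k * c T k = 0"
        using semigroup_stays_in_closed_set[OF p S A closed] T A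
        by (auto simp: c_def intro!: sum.neutral)
    qed auto
    also have "\<dots> \<le> (\<Sum>k\<in>S-A. p (real n * T) i k * r)"
      by (intro sum_mono mult_left_mono) (use r nonneg nT i in auto)
    also have "\<dots> = c (real n * T) i * r" by (simp add: c_def sum_distrib_right)
    also have "\<dots> \<le> r ^ n * r" using Suc r by (intro mult_right_mono)
    finally show ?case by (simp add: algebra_simps)
  qed
  with that[OF T r(1,2)] show ?thesis unfolding c_def by blast
qed

section \<open>Sample paths: measurability, two-time laws and almost sure absorption\<close>

context ctmc
begin

lemma state_in_S: "t \<ge> 0 \<Longrightarrow> \<omega> \<in> space M \<Longrightarrow> X t \<omega> \<in> S"
  using measurable_space[OF measurable_X] by simp

lemma state_in_events:
  assumes "t \<ge> 0"
  shows "{\<omega> \<in> space M. X t \<omega> \<in> A} \<in> events"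
proof -
  have "X t -` (A \<inter> S) \<inter> space M \<in> events"
    by (rule measurable_sets[OF measurable_X[OF assms]]) simp
  also have "X t -` (A \<inter> S) \<inter> space M = {\<omega> \<in> space M. X t \<omega> \<in> A}"
    using state_in_S assms by auto
  finally show ?thesis .
qed

text \<open>Right continuity in the discrete topology makes the path constant just after
  \<open>t\<close>, and that interval contains a rational. Statements about all later times thus
  reduce to countably many times.\<close>

lemma state_at_later_rational:
  assumes "\<omega> \<in> space M" and t: "t \<ge> 0"
  obtains r :: rat where "of_rat r > t" "X (of_rat r) \<omega> = X t \<omega>"
proof -
  obtain b where b: "b > t" "\<And>s. t < s \<Longrightarrow> s < b \<Longrightarrow> X s \<omega> = X t \<omega>"
    using right_continuous[OF assms] unfolding eventually_at_right_field by blast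
  obtain r :: rat where "t < of_rat r" "of_rat r < b"
    using of_rat_dense[OF b(1)] by blast
  with b(2) that show ?thesis by blast
qed

lemma always_later_iff_rational:
  assumes "\<omega> \<in> space M" and s: "s \<ge> 0"
  shows "(\<forall>t>s. X t \<omega> \<in> A) \<longleftrightarrow> (\<forall>r::rat. of_rat r > s \<longrightarrow> X (of_rat r) \<omega> \<in> A)"
proof (intro iffI allI impI)
  fix t assume *: "\<forall>r::rat. of_rat r > s \<longrightarrow> X (of_rat r) \<omega> \<in> A" and "t > s"
  then obtain r :: rat where "of_rat r > t" "X (of_rat r) \<omega> = X t \<omega>"
    using state_at_later_rational[OF assms(1), of t] s by auto
  with * \<open>t > s\<close> show "X t \<omega> \<in> A" by (metis less_trans)
qed auto

lemma eventually_always_in_events: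
  "{\<omega> \<in> space M. \<exists>t0\<ge>0. \<forall>t\<ge>t0. X t \<omega> \<in> A} \<in> events"
proof -
  have "(\<exists>t0\<ge>0. \<forall>t\<ge>t0. X t \<omega> \<in> A) \<longleftrightarrow> (\<exists>n. \<forall>r::rat. of_rat r > real n \<longrightarrow> X (of_rat r) \<omega> \<in> A)"
    if "\<omega> \<in> space M" for \<omega>
  proof -
    have "(\<exists>t0\<ge>0. \<forall>t\<ge>t0. X t \<omega> \<in> A) \<longleftrightarrow> (\<exists>n::nat. \<forall>t>real n. X t \<omega> \<in> A)"
    proof
      assume "\<exists>t0\<ge>0. \<forall>t\<ge>t0. X t \<omega> \<in> A"
      then obtain t0 where t0: "\<forall>t\<ge>t0. X t \<omega> \<in> A" by blast
      obtain n where "t0 \<le> real n" using real_arch_simple by blast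
      then have "\<forall>t>real n. X t \<omega> \<in> A" using t0 by auto
      then show "\<exists>n::nat. \<forall>t>real n. X t \<omega> \<in> A" by blast
    next
      assume "\<exists>n::nat. \<forall>t>real n. X t \<omega> \<in> A"
      then obtain n :: nat where n: "\<forall>t>real n. X t \<omega> \<in> A" by blast
      show "\<exists>t0\<ge>0. \<forall>t\<ge>t0. X t \<omega> \<in> A"
        \<comment> \<open>Adding 1 passes from a strict to a non-strict bound on
          \<open>t\<close>.\<close>
        by (rule exI[of _ "real n + 1"]) (use n in auto)
    qed
    then show ?thesis using always_later_iff_rational[OF that] by simp
  qed
  then have "{\<omega> \<in> space M. \<exists>t0\<ge>0. \<forall>t\<ge>t0. X t \<omega> \<in> A} =
      {\<omega> \<in> space M. \<exists>n. \<forall>r::rat. of_rat r > real n \<longrightarrow> X (of_rat r) \<omega> \<in> A}"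
    by (intro Collect_cong conj_cong) auto
  also have "\<dots> \<in> events"
  proof (intro sets.sets_Collect_countable_Ex sets.sets_Collect_countable_All)
    fix n :: nat and r :: rat
    show "{\<omega> \<in> space M. of_rat r > real n \<longrightarrow> X (of_rat r) \<omega> \<in> A} \<in> events"
    proof (cases "of_rat r > real n")
      case True
      then have "of_rat r \<ge> (0::real)" by (meson less_imp_le of_nat_0_le_iff order_trans)
      with True show ?thesis using state_in_events by simp
    qed simp
  qed
  finally show ?thesis .
qed

text \<open>The Markov property with one past time (\<open>n = 0\<close>), multiplied out. In this
  form it also covers conditioning events of probability 0, where both sides vanish.\<close>

lemma joint_prob:
  assumes p: "\<forall>(n::nat) (t :: nat \<Rightarrow> real) (i :: nat \<Rightarrow> 's).
           0 \<le> t 0 \<and> (\<forall>k\<le>n. t k < t (Suc k)) \<and> (\<forall>k\<le>Suc n. i k \<in> S) \<and>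
           \<P>(\<omega> in M. \<forall>k\<le>n. X (t k) \<omega> = i k) > 0 \<longrightarrow>
           \<P>(\<omega> in M. X (t (Suc n)) \<omega> = i (Suc n) \<bar> \<forall>k\<le>n. X (t k) \<omega> = i k)
             = p (t (Suc n) - t n) (i n) (i (Suc n))"
    and st: "0 \<le> s" "s < t" and ij: "i \<in> S" "j \<in> S"
  shows "\<P>(\<omega> in M. X t \<omega> = j \<and> X s \<omega> = i) = \<P>(\<omega> in M. X s \<omega> = i) * p (t - s) i j"
proof (cases "\<P>(\<omega> in M. X s \<omega> = i) = 0")
  case True
  have "\<P>(\<omega> in M. X t \<omega> = j \<and> X s \<omega> = i) \<le> \<P>(\<omega> in M. X s \<omega> = i)"
    using state_in_events[OF st(1), of "{i}"] by (intro finite_measure_mono) auto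
  with True show ?thesis by (simp add: measure_le_0_iff)
next
  case False
  then have pos: "\<P>(\<omega> in M. X s \<omega> = i) > 0" by (simp add: zero_less_measure_iff)
  have "\<P>(\<omega> in M. X t \<omega> = j \<bar> X s \<omega> = i) = p (t - s) i j"
    using p[rule_format, of "\<lambda>k. if k = 0 then s else t" 0 "\<lambda>k. if k = 0 then i else j"] st ij pos
    by simp
  with pos show ?thesis by (simp add: cond_prob_def field_simps)
qed

text \<open>Almost surely the path is in \<open>A\<close> at some multiple of \<open>T\<close>, and
  almost surely it is then in \<open>A\<close> at every later rational time. Right continuity
  extends this to all later times.\<close>

theorem AE_eventually_always_in_closed_set:
  assumes A: "A \<subseteq> S"
    and closed: "\<And>i j. i \<in> A \<Longrightarrow> j \<in> S - A \<Longrightarrow> q i j = 0"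
    and reach: "\<And>i. i \<in> S \<Longrightarrow> \<exists>j\<in>A. (i, j) \<in> {(i, j). i \<in> S \<and> j \<in> S \<and> q i j > 0}\<^sup>*"
  shows "AE \<omega> in M. \<exists>t0\<ge>0. \<forall>t\<ge>t0. X t \<omega> \<in> A"
proof -
  obtain p where p: "transition_semigroup S q p" and mk: "\<forall>(n::nat) (t :: nat \<Rightarrow> real) (i :: nat \<Rightarrow> 's).
           0 \<le> t 0 \<and> (\<forall>k\<le>n. t k < t (Suc k)) \<and> (\<forall>k\<le>Suc n. i k \<in> S) \<and>
           \<P>(\<omega> in M. \<forall>k\<le>n. X (t k) \<omega> = i k) > 0 \<longrightarrow>
           \<P>(\<omega> in M. X (t (Suc n)) \<omega> = i (Suc n) \<bar> \<forall>k\<le>n. X (t k) \<omega> = i k)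
             = p (t (Suc n) - t n) (i n) (i (Suc n))"
    using markov by blast
  note joint = joint_prob[OF mk]
  obtain T r where T: "T > 0" and r: "0 \<le> r" "r < 1"
    and geom: "\<And>n i. i \<in> S \<Longrightarrow> (\<Sum>j\<in>S-A. p (real n * T) i j) \<le> r ^ n"
    using semigroup_geometric_absorption[OF p finite_states A closed reach] by blast
  have fin: "finite A" "finite (S - A)" using finite_states A finite_subset by auto
  have joint_sets: "{\<omega> \<in> space M. X t \<omega> = j \<and> X s \<omega> = i} \<in> events" if "0 \<le> s" "0 \<le> t" for s t i j
    using sets.Int[OF state_in_events[OF that(1), of "{i}"] state_in_events[OF that(2), of "{j}"]]
    by (rule back_subst[of "\<lambda>A. A \<in> events"]) auto
  \<comment> \<open>The null set here depends on \<open>s\<close> and \<open>t\<close>, so the fact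
    may be combined over countably many pairs only.\<close>
  have stay: "AE \<omega> in M. X s \<omega> \<in> A \<longrightarrow> X t \<omega> \<in> A" if st: "0 \<le> s" "s < t" for s t
  proof -
    have "AE \<omega> in M. \<not> (X t \<omega> = j \<and> X s \<omega> = i)" if "i \<in> A" "j \<in> S - A" for i j
    proof -
      have "p (t - s) i j = 0"
        by (rule semigroup_stays_in_closed_set[OF p finite_states A closed]) (use st that in auto)
      then have "\<P>(\<omega> in M. X t \<omega> = j \<and> X s \<omega> = i) = 0"
        using joint[OF st, of i j] that A by auto
      then show ?thesis
        using prob_Collect_eq_0[OF joint_sets] st by simp
    qed
    then have "AE \<omega> in M. \<forall>i\<in>A. \<forall>j\<in>S-A. \<not> (X t \<omega> = j \<and> X s \<omega> = i)"
      using fin by (intro AE_finite_allI) auto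
    then show ?thesis
      by (rule AE_mp) (rule AE_I2, use state_in_S[of t] st in auto)
  qed
  have hit: "AE \<omega> in M. \<exists>n. X (real n * T) \<omega> \<in> A"
  proof -
    define N where "N n = {\<omega> \<in> space M. X (real n * T) \<omega> \<in> S - A}" for n
    have N: "N n \<in> events" for n
      unfolding N_def by (rule state_in_events) (use T in simp)
    \<comment> \<open>The initial law is arbitrary: each initial state gets weight at most 1, whence
      the factor \<open>card S\<close>. The two-time law needs distinct times 0 and
      \<open>n * T\<close>, hence \<open>n > 0\<close>.\<close>
    have "prob (N n) \<le> real (card S) * r ^ n" if n: "n > 0" for n
    proof -
      have nT: "0 < real n * T" using n T by simp
      let ?B = "\<lambda>(i, j). {\<omega> \<in> space M. X (real n * T) \<omega> = j \<and> X 0 \<omega> = i}"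
      have "prob (N n) \<le> prob (\<Union>(?B ` (S \<times> (S - A))))"
        using finite_states fin joint_sets nT state_in_S[of 0]
        by (intro finite_measure_mono sets.finite_UN) (auto simp: N_def)
      also have "\<dots> \<le> (\<Sum>ij\<in>S \<times> (S - A). prob (?B ij))"
        using finite_states fin joint_sets nT by (intro finite_measure_subadditive_finite) auto
      also have "\<dots> = (\<Sum>i\<in>S. \<Sum>j\<in>S-A. prob (?B (i, j)))"
        unfolding sum.cartesian_product by (rule sum.cong) auto
      also have "\<dots> = (\<Sum>i\<in>S. \<P>(\<omega> in M. X 0 \<omega> = i) * (\<Sum>j\<in>S-A. p (real n * T) i j))"
        using joint[OF order_refl nT] by (simp add: sum_distrib_left)
      also have "\<dots> \<le> (\<Sum>i\<in>S. 1 * r ^ n)"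
        using r nT by (intro sum_mono mult_mono geom sum_nonneg)
          (auto intro: transition_semigroup_nonneg[OF p])
      finally show ?thesis by simp
    qed
    then have "prob (\<Inter>n. N n) \<le> real (card S) * r ^ Suc n" for n
      by (meson INF_lower N UNIV_I finite_measure_mono order_trans zero_less_Suc)
    moreover have "(\<lambda>n. real (card S) * r ^ Suc n) \<longlonglongrightarrow> real (card S) * 0"
      by (intro tendsto_mult tendsto_const LIMSEQ_Suc[OF LIMSEQ_realpow_zero] r)
    ultimately have "prob (\<Inter>n. N n) \<le> real (card S) * 0"
      by (intro LIMSEQ_le_const) auto
    then have "prob (\<Inter>n. N n) = 0" by (simp add: measure_le_0_iff)
    moreover have "(\<Inter>n. N n) = {\<omega> \<in> space M. \<not> (\<exists>n. X (real n * T) \<omega> \<in> A)}"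
      using state_in_S T by (auto simp: N_def)
    moreover have "(\<Inter>n. N n) \<in> events" using N by auto
    ultimately show ?thesis
      using prob_Collect_eq_0[of "\<lambda>\<omega>. \<not> (\<exists>n. X (real n * T) \<omega> \<in> A)"] by simp
  qed
  \<comment> \<open>Pairs of a multiple of \<open>T\<close> and a rational are countable, so the
    exceptional sets still form a null set.\<close>
  have "AE \<omega> in M. \<forall>n (r::rat). of_rat r > real n * T \<longrightarrow> X (real n * T) \<omega> \<in> A \<longrightarrow> X (of_rat r) \<omega> \<in> A"
    unfolding AE_all_countable using stay T by simp
  with hit show ?thesis
  proof (rule AE_mp[OF _ AE_mp], intro AE_I2 impI)
    fix \<omega> assume \<omega>: "\<omega> \<in> space M" and "\<exists>n. X (real n * T) \<omega> \<in> A"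
      and later: "\<forall>n (r::rat). of_rat r > real n * T \<longrightarrow> X (real n * T) \<omega> \<in> A \<longrightarrow> X (of_rat r) \<omega> \<in> A"
    then obtain n where n: "X (real n * T) \<omega> \<in> A" by blast
    have nT: "real n * T \<ge> 0" using T by simp
    have "\<forall>t>real n * T. X t \<omega> \<in> A"
      using always_later_iff_rational[OF \<omega> nT] later n by blast
    with n have "\<forall>t\<ge>real n * T. X t \<omega> \<in> A" by (metis order_le_less)
    with nT show "\<exists>t0\<ge>0. \<forall>t\<ge>t0. X t \<omega> \<in> A" by blast
  qed
qed

end

section \<open>Reaching the allocation states\<close>

text \<open>An entry is at most its row sum, so the matrices lie in a finite product of
  intervals.\<close>

lemma finite_partial_allocs: "finite (partial_allocs E \<alpha> \<beta>)"
proof (rule finite_subset)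
  show "partial_allocs E \<alpha> \<beta> \<subseteq> (\<Pi>\<^sub>E x\<in>UNIV. \<Pi>\<^sub>E y\<in>UNIV. {..\<alpha> x})"
  proof (intro subsetI)
    fix W assume "W \<in> partial_allocs E \<alpha> \<beta>"
    then have "row_sum W x \<le> \<alpha> x" for x by (simp add: partial_allocs_def)
    moreover have "W x y \<le> row_sum W x" for x y
      unfolding row_sum_def by (rule member_le_sum) auto
    ultimately show "W \<in> (\<Pi>\<^sub>E x\<in>UNIV. \<Pi>\<^sub>E y\<in>UNIV. {..\<alpha> x})"
      by (auto simp: PiE_UNIV_domain intro: order_trans)
  qed
qed (intro finite_PiE, auto)

text \<open>One step of an alternating walk: \<open>x'\<close> occupies a unit of a column that
  \<open>x\<close> may use, so if \<open>x'\<close> moves that unit elsewhere, room appears for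
  \<open>x\<close>.\<close>

definition exchange_rel :: "'x rel \<Rightarrow> 'x alloc \<Rightarrow> 'x rel" where
  "exchange_rel E W = {(x, x'). \<exists>y. (x, y) \<in> E \<and> W x' y > 0}"

text \<open>Let \<open>D\<close> be the set of vertices reachable from \<open>x\<close>. If every
  column adjacent to \<open>D\<close> were full, these columns would be filled by rows of
  \<open>D\<close> alone, since any row with a positive entry there is reachable too. Their total
  capacity would then be at most the row sums over \<open>D\<close>, which stay below the sum of
  \<open>\<alpha>\<close> over \<open>D\<close>.\<close>

lemma exchange_to_unsaturated:
  fixes E :: "('x::finite) rel"
  assumes W: "W \<in> partial_allocs E \<alpha> \<beta>"
    and capacity: "\<And>D :: 'x set. (\<Sum>x\<in>D. \<alpha> x) \<le> (\<Sum>y\<in>E `` D. \<beta> y)"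
    and x: "row_sum W x < \<alpha> x"
  obtains z y where "(x, z) \<in> (exchange_rel E W)\<^sup>*" "(z, y) \<in> E" "col_sum W y < \<beta> y"
proof (rule ccontr)
  assume no: "\<not> thesis"
  note found = that
  define D where "D = (exchange_rel E W)\<^sup>* `` {x}"
  have full: "col_sum W y = \<beta> y" if y: "y \<in> E `` D" for y
  proof -
    have "\<not> col_sum W y < \<beta> y" using y found no unfolding D_def by blast
    then show ?thesis using W by (simp add: partial_allocs_def order_antisym not_less)
  qed
  have closed: "z \<in> D" if "y \<in> E `` D" "W z y \<noteq> 0" for y z
    using that unfolding D_def exchange_rel_def by (auto intro: rtrancl_into_rtrancl)
  have "(\<Sum>y\<in>E `` D. \<beta> y) = (\<Sum>y\<in>E `` D. \<Sum>z\<in>D. W z y)"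
  proof (rule sum.cong[OF refl])
    fix y assume y: "y \<in> E `` D"
    have "\<beta> y = (\<Sum>z\<in>UNIV. W z y)" using full[OF y] by (simp add: col_sum_def)
    also have "\<dots> = (\<Sum>z\<in>D. W z y)"
      using closed[OF y] by (intro sum.mono_neutral_right) auto
    finally show "\<beta> y = (\<Sum>z\<in>D. W z y)" .
  qed
  also have "\<dots> = (\<Sum>z\<in>D. \<Sum>y\<in>E `` D. W z y)" by (rule sum.swap)
  also have "\<dots> \<le> (\<Sum>z\<in>D. row_sum W z)"
    unfolding row_sum_def by (intro sum_mono sum_mono2) auto
  \<comment> \<open>Strictness comes from \<open>x\<close>, which lies in \<open>D\<close> by
    reflexivity.\<close>
  also have "\<dots> < (\<Sum>z\<in>D. \<alpha> z)"
    by (rule sum_strict_mono_ex1) (use W x in \<open>auto simp: partial_allocs_def D_def\<close>)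
  finally show False using capacity[of D] by simp
qed

text \<open>This monotonicity makes the set of allocation states closed and keeps the total from
  dropping during exchanges.\<close>

lemma available_moves_row_sum:
  assumes "W' \<in> available_moves E \<alpha> \<beta> a W \<xi>"
  shows "row_sum W x \<le> row_sum W' x"
proof (cases "x = a")
  case False
  then have "W' x y = W x y" for y using assms by (simp add: available_moves_def)
  then show ?thesis by (simp add: row_sum_def)
qed (use assms in \<open>simp add: available_moves_def\<close>)

lemma available_moves_total:
  "W' \<in> available_moves E \<alpha> \<beta> a W \<xi> \<Longrightarrow> total W \<le> total W'"
  using sum_mono[of UNIV "row_sum W" "row_sum W'"] available_moves_row_sum[of W' E \<alpha> \<beta> a W \<xi>]
  by (auto simp: total_def row_sum_def)

section \<open>Moves of an admissible family and their rates\<close>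

context
  fixes E :: "('x::finite) rel" and \<alpha> \<beta> :: "'x \<Rightarrow> nat"
    and \<M> :: "'x \<Rightarrow> 'x alloc \<Rightarrow> 'x func \<Rightarrow> 'x alloc set"
    and U :: "'x \<Rightarrow> 'x alloc \<Rightarrow> real" and \<gamma> :: real and \<nu>on \<nu>off \<nu>act :: "'x \<Rightarrow> real"
  assumes admissible: "admissible_family E \<alpha> \<beta> \<M>"
begin

lemmas admissible_moves = admissible[unfolded admissible_family_def, THEN spec, THEN spec, THEN mp,
    THEN conjunct1, THEN bspec]

lemma moves_available:
  assumes "W \<in> partial_allocs E \<alpha> \<beta>" "\<xi> a"
  shows "\<M> a W \<xi> \<subseteq> available_moves E \<alpha> \<beta> a W \<xi>"
  using admissible_moves[of \<xi> a W] assms by simp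

lemma moves_partial_alloc:
  "W \<in> partial_allocs E \<alpha> \<beta> \<Longrightarrow> \<xi> a \<Longrightarrow> W' \<in> \<M> a W \<xi> \<Longrightarrow> W' \<in> partial_allocs E \<alpha> \<beta>"
  using moves_available unfolding available_moves_def by blast

lemma moves_add:
  assumes "W \<in> partial_allocs E \<alpha> \<beta>" "\<xi> a" "y \<in> available_nbrs E \<beta> a W \<xi>" "row_sum W a < \<alpha> a"
  obtains n where "n \<ge> 1" "(\<lambda>u v. W u v + n * unit_alloc a y u v) \<in> \<M> a W \<xi>"
  using admissible_moves[of \<xi> a W] assms that by blast

lemma moves_exchange:
  assumes "W \<in> partial_allocs E \<alpha> \<beta>" "\<xi> a" "y \<in> available_nbrs E \<beta> a W \<xi>"
    "W a y' > 0" "\<xi> y'" "y \<noteq> y'"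
  shows "(\<lambda>u v. W u v + unit_alloc a y u v - unit_alloc a y' u v) \<in> \<M> a W \<xi>"
  using admissible_moves[of \<xi> a W] assms by blast

text \<open>A move cannot lower a row sum, and in an allocation state all row sums are already
  maximal. The index set of the activity sum is therefore empty, and \<open>W' \<noteq> W\<close>
  excludes a mere switch.\<close>

lemma rate_leaving_allocs:
  assumes W: "W \<in> allocs E \<alpha> \<beta>" and W': "W' \<in> partial_allocs E \<alpha> \<beta> - allocs E \<alpha> \<beta>"
  shows "alloc_rate \<gamma> U \<M> \<nu>on \<nu>off \<nu>act (W, \<xi>) (W', \<xi>') = 0"
proof -
  have "W' \<notin> \<M> a W \<xi>" if "\<xi> a" for a
  proof
    assume "W' \<in> \<M> a W \<xi>"
    then have "W' \<in> available_moves E \<alpha> \<beta> a W \<xi>"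
      using moves_available[of W \<xi> a] that W by (auto simp: allocs_def)
    then have "\<alpha> x \<le> row_sum W' x" for x
      using available_moves_row_sum[of W' E \<alpha> \<beta> a W \<xi> x] W by (simp add: allocs_def)
    then have "W' \<in> allocs E \<alpha> \<beta>"
      using W' by (auto simp: allocs_def partial_allocs_def intro: order_antisym)
    then show False using W' by simp
  qed
  then have "{a. \<xi> a \<and> W' \<in> \<M> a W \<xi>} = {}" by blast
  moreover have "W' \<noteq> W" using W W' by auto
  ultimately show ?thesis unfolding alloc_rate.simps by (simp only: sum.empty if_False if_cancel)
qed

section \<open>Positive rates and reachability of the allocation states\<close>

context
  assumes rates: "\<And>x. \<nu>on x > 0" "\<And>x. \<nu>act x > 0"
begin

text \<open>The partition sum at \<open>W\<close> contains the term of \<open>W'\<close>, hence is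
  positive, and so is its maximum with any other value. Totals do not decrease, so the zero branch
  of \<open>move_prob\<close> is excluded.\<close>

lemma rate_of_move_pos:
  assumes W: "W \<in> partial_allocs E \<alpha> \<beta>" and a: "\<xi> a" and W': "W' \<in> \<M> a W \<xi>"
  shows "alloc_rate \<gamma> U \<M> \<nu>on \<nu>off \<nu>act (W, \<xi>) (W', \<xi>) > 0"
proof -
  have avail: "W' \<in> available_moves E \<alpha> \<beta> a W \<xi>" using moves_available[of W \<xi> a] W a W' by blast
  then have "W' \<noteq> W" by (simp add: available_moves_def)
  have nonneg: "partition_sum \<gamma> U \<M> b V \<xi> \<ge> 0" for b V
    unfolding partition_sum_def by (intro sum_nonneg) simp
  have "finite (\<M> a W \<xi>)"
    using finite_partial_allocs[of E \<alpha> \<beta>] moves_partial_alloc[of W \<xi> a] W a by (meson finite_subset subsetI)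
  then have "partition_sum \<gamma> U \<M> a W \<xi> > 0"
    unfolding partition_sum_def using W' by (intro sum_pos) auto
  then have "move_prob \<gamma> U \<M> a W \<xi> W' > 0"
    using available_moves_total[OF avail] by (auto simp: move_prob_def less_max_iff_disj)
  \<comment> \<open>Nonnegativity of the other terms replaces an argument that \<open>a\<close> is
    the only vertex in the sum.\<close>
  moreover have "move_prob \<gamma> U \<M> b W \<xi> W' \<ge> 0" for b
    using nonneg[of b W] by (auto simp: move_prob_def nonneg intro!: divide_nonneg_nonneg le_max_iff_disj[THEN iffD2])
  ultimately have "(\<Sum>b | \<xi> b \<and> W' \<in> \<M> b W \<xi>. \<nu>act b * move_prob \<gamma> U \<M> b W \<xi> W') > 0"
    using rates(2) a W' by (intro sum_pos2[of _ a]) (auto intro!: mult_nonneg_nonneg less_imp_le[OF rates(2)])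
  with \<open>W' \<noteq> W\<close> show ?thesis by simp
qed

text \<open>The positive-rate graph, in the shape required by
  \<open>AE_eventually_always_in_closed_set\<close>.\<close>

abbreviation "steps \<equiv> {(s, s'). s \<in> partial_allocs E \<alpha> \<beta> \<times> UNIV \<and> s' \<in> partial_allocs E \<alpha> \<beta> \<times> UNIV \<and>
    alloc_rate \<gamma> U \<M> \<nu>on \<nu>off \<nu>act s s' > 0}"

text \<open>Inactive vertices are switched on one at a time, each at a positive rate; the induction
  counts those still off.\<close>

lemma steps_activate:
  assumes W: "W \<in> partial_allocs E \<alpha> \<beta>"
  shows "((W, \<xi>), (W, \<lambda>_. True)) \<in> steps\<^sup>*"
proof (induction "card {x. \<not> \<xi> x}" arbitrary: \<xi>)
  case 0
  then have "\<xi> = (\<lambda>_. True)" by auto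
  then show ?case by simp
next
  case (Suc n)
  then obtain a where a: "\<not> \<xi> a" by (metis (mono_tags, lifting) Collect_empty_eq card.empty nat.distinct(1))
  let ?\<xi> = "\<xi>(a := True)"
  have "{b. ?\<xi> = \<xi>(b := \<not> \<xi> b)} = {a}"
    using a by (auto simp: fun_eq_iff split: if_splits)
  then have "((W, \<xi>), (W, ?\<xi>)) \<in> steps" using W rates(1) a by simp
  moreover have "{x. \<not> \<xi> x} = insert a {x. \<not> ?\<xi> x}" using a by auto
  then have "n = card {x. \<not> ?\<xi> x}" using Suc(2) by simp
  then have "((W, ?\<xi>), (W, \<lambda>_. True)) \<in> steps\<^sup>*" by (rule Suc(1))
  ultimately show ?case by (rule converse_rtrancl_into_rtrancl)
qed

lemma steps_move:
  "W \<in> partial_allocs E \<alpha> \<beta> \<Longrightarrow> W' \<in> \<M> a W (\<lambda>_. True) \<Longrightarrow> ((W, \<lambda>_. True), (W', \<lambda>_. True)) \<in> steps"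
  using rate_of_move_pos[of W "\<lambda>_. True" a W'] moves_partial_alloc[of W "\<lambda>_. True" a W'] by simp


text \<open>Strong induction on the walk length, for all states at once because an exchange changes
  \<open>W\<close>. Exchanges never lower the total, and the final addition by \<open>x\<close>
  raises it.\<close>

lemma steps_increase_total_along_walk:
  assumes "W \<in> partial_allocs E \<alpha> \<beta>" "row_sum W x < \<alpha> x"
    "(x, z) \<in> exchange_rel E W ^^ k" "(z, y) \<in> E" "col_sum W y < \<beta> y"
  shows "\<exists>W'\<in>partial_allocs E \<alpha> \<beta>. total W < total W' \<and>
    ((W, \<lambda>_. True), (W', \<lambda>_. True)) \<in> steps\<^sup>*"
  using assms
proof (induction k arbitrary: W z y rule: less_induct)
  case (less k)
  note W = less.prems(1)
  have move: "((W, \<lambda>_. True), (V, \<lambda>_. True)) \<in> steps" if "V \<in> \<M> a W (\<lambda>_. True)" for a V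
    using W that by (rule steps_move)
  have y: "y \<in> available_nbrs E \<beta> z W (\<lambda>_. True)"
    using less.prems by (simp add: available_nbrs_def)
  show ?case
  \<comment> \<open>A shorter walk in the same state is covered by the induction hypothesis;
    otherwise \<open>k\<close> is minimal.\<close>
  proof (cases "\<exists>m z' y'. m < k \<and> (x, z') \<in> exchange_rel E W ^^ m \<and> (z', y') \<in> E \<and> col_sum W y' < \<beta> y'")
    case True
    then show ?thesis using less.IH W less.prems(2) by blast
  next
    case minimal: False
    show ?thesis
    proof (cases k)
      case 0
      then have "z = x" using less.prems(3) by simp
      then obtain n where n: "n \<ge> 1"
        and W': "(\<lambda>u v. W u v + n * unit_alloc x y u v) \<in> \<M> x W (\<lambda>_. True)" (is "?W' \<in> _")
        using moves_add[of W "\<lambda>_. True" x y] W y less.prems(2) by blast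
      have "(\<Sum>u\<in>UNIV. \<Sum>v\<in>UNIV. unit_alloc x y u v) = 1"
      proof -
        have "(\<Sum>v\<in>UNIV. unit_alloc x y u v) = (if u = x then 1 else 0)" for u
          by (simp add: unit_alloc_def)
        then show ?thesis by simp
      qed
      then have "total ?W' = total W + n"
        by (simp add: total_def sum.distrib flip: sum_distrib_left)
      moreover have "?W' \<in> partial_allocs E \<alpha> \<beta>"
        using moves_partial_alloc[of W \<open>\<lambda>_. True\<close> x] W W' by simp
      ultimately show ?thesis using n move[OF W'] by (intro bexI[of _ ?W']) auto
    next
      case (Suc m)
      obtain f where f: "f 0 = x" "f k = z" "\<And>i. i < k \<Longrightarrow> (f i, f (Suc i)) \<in> exchange_rel E W"
        using less.prems(3) unfolding relpow_fun_conv by blast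
      have prefix: "(x, f i) \<in> exchange_rel E W ^^ i" if "i \<le> k" for i
        unfolding relpow_fun_conv using that f by (intro exI[of _ f]) auto
      \<comment> \<open>An earlier visit to \<open>z\<close> would give a shorter walk ending next
        to the unsaturated column \<open>y\<close>.\<close>
      have fresh: "f i \<noteq> z" if "i < k" for i
        using minimal prefix[of i] that less.prems(4,5) by auto
      obtain y' where y': "(f m, y') \<in> E" "W z y' > 0"
        using f(2) f(3)[of m] Suc by (auto simp: exchange_rel_def)
      \<comment> \<open>Otherwise the walk could stop at \<open>f m\<close>. So \<open>y'\<close> is
        full and differs from \<open>y\<close>, as the exchange requires.\<close>
      have "\<not> col_sum W y' < \<beta> y'"
        using minimal prefix[of m] y' Suc by auto
      then have "y \<noteq> y'" using less.prems(5) by auto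
      define W' where "W' = (\<lambda>u v. W u v + unit_alloc z y u v - unit_alloc z y' u v)"
      have W'M: "W' \<in> \<M> z W (\<lambda>_. True)"
        using moves_exchange[of W "\<lambda>_. True" z y y'] W y y' \<open>y \<noteq> y'\<close> unfolding W'_def by simp
      have W': "W' \<in> partial_allocs E \<alpha> \<beta>"
        using moves_partial_alloc[of W \<open>\<lambda>_. True\<close> z] W W'M by simp
      have same: "W' u = W u" if "u \<noteq> z" for u
        using that by (auto simp: W'_def unit_alloc_def)
      have "row_sum W' x < \<alpha> x"
        using less.prems(2) same[of x] fresh[of 0] f(1) Suc by (simp add: row_sum_def)
      moreover have "(x, f m) \<in> exchange_rel E W' ^^ m"
        unfolding relpow_fun_conv
      proof (intro exI[of _ f] conjI allI impI)
        \<comment> \<open>The relation reads the matrix only in the row of its second vertex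
          \<open>f (Suc i)\<close>, which is not the altered row \<open>z\<close>.\<close>
        fix i assume "i < m"
        then show "(f i, f (Suc i)) \<in> exchange_rel E W'"
          using f(3)[of i] same[OF fresh[of "Suc i"]] Suc by (simp add: exchange_rel_def)
      qed (use f in auto)
      moreover have "col_sum W' y' < \<beta> y'"
      proof -
        \<comment> \<open>In column \<open>y'\<close> only the entry of row \<open>z\<close>
          changes, and it drops by one.\<close>
        have "col_sum W' y' < col_sum W y'"
          unfolding col_sum_def
          by (rule sum_strict_mono_ex1)
            (use y' \<open>y \<noteq> y'\<close> in \<open>auto simp: W'_def unit_alloc_def intro!: bexI[of _ z]\<close>)
        also have "\<dots> \<le> \<beta> y'" using W by (simp add: partial_allocs_def)
        finally show ?thesis .
      qed
      ultimately obtain W'' where "W'' \<in> partial_allocs E \<alpha> \<beta>" "total W' < total W''"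
        "((W', \<lambda>_. True), (W'', \<lambda>_. True)) \<in> steps\<^sup>*"
        using less.IH[of m W' "f m" y'] W' y'(1) Suc by auto
      moreover have "total W \<le> total W'"
        using available_moves_total[of W' E \<alpha> \<beta> z W "\<lambda>_. True"] moves_available[of W "\<lambda>_. True" z] W W'M
        by blast
      ultimately show ?thesis
        using converse_rtrancl_into_rtrancl[OF move[OF W'M]] by (meson le_less_trans)
    qed
  qed
qed

text \<open>After activating all vertices, the gap between the sum of \<open>\<alpha>\<close> and
  the total is closed by repeated increases.\<close>

lemma steps_reach_allocs:
  assumes capacity: "\<And>D :: 'x set. (\<Sum>x\<in>D. \<alpha> x) \<le> (\<Sum>y\<in>E `` D. \<beta> y)"
    and W: "W \<in> partial_allocs E \<alpha> \<beta>"
  shows "\<exists>W'\<in>allocs E \<alpha> \<beta>.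
    ((W, \<xi>), (W', \<lambda>_. True)) \<in> steps\<^sup>*"
proof -
  have "\<exists>W'\<in>allocs E \<alpha> \<beta>.
    ((W, \<lambda>_. True), (W', \<lambda>_. True)) \<in> steps\<^sup>*"
    using W
  proof (induction "(\<Sum>x\<in>UNIV. \<alpha> x) - total W" arbitrary: W rule: less_induct)
    case less
    show ?case
    proof (cases "W \<in> allocs E \<alpha> \<beta>")
      case False
      then obtain x where x: "row_sum W x < \<alpha> x"
        using less.prems by (auto simp: allocs_def partial_allocs_def le_less)
      obtain z y where "(x, z) \<in> (exchange_rel E W)\<^sup>*" "(z, y) \<in> E" "col_sum W y < \<beta> y"
        using exchange_to_unsaturated[OF less.prems capacity x] by blast
      then obtain V where V: "V \<in> partial_allocs E \<alpha> \<beta>" "total W < total V"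
        "((W, \<lambda>_. True), (V, \<lambda>_. True)) \<in> steps\<^sup>*"
        using steps_increase_total_along_walk[OF less.prems x] by (meson rtrancl_imp_relpow)
      \<comment> \<open>This bound prevents truncation in the natural-number gap, so the gap
        strictly decreases.\<close>
      have "total V \<le> (\<Sum>x\<in>UNIV. \<alpha> x)"
        using V(1) unfolding total_def by (intro sum_mono) (simp add: partial_allocs_def row_sum_def)
      then obtain W' where "W' \<in> allocs E \<alpha> \<beta>"
        "((V, \<lambda>_. True), (W', \<lambda>_. True)) \<in> steps\<^sup>*"
        using less.hyps[of V] V(1,2) by fastforce
      with V(3) show ?thesis by (meson rtrancl_trans)
    qed blast
  qed
  then show ?thesis
    using steps_activate[OF W, of \<xi>]
    by (meson rtrancl_trans)
qed

end

end

theorem corollary7: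
  fixes E :: "('x::finite) rel"
    and \<alpha> \<beta> :: "'x \<Rightarrow> nat"
    and \<M> :: "'x \<Rightarrow> 'x alloc \<Rightarrow> 'x func \<Rightarrow> 'x alloc set"
    and \<Psi> :: "'x alloc \<Rightarrow> real"
    and f g :: "'x \<Rightarrow> ('x \<Rightarrow> nat) \<Rightarrow> real"
    and U :: "'x \<Rightarrow> 'x alloc \<Rightarrow> real"
    and \<gamma> :: real
    and \<nu>on \<nu>off \<nu>act :: "'x \<Rightarrow> real"
    and M :: "'w measure"
    and X :: "real \<Rightarrow> 'w \<Rightarrow> 'x alloc \<times> 'x func"
  assumes potential: "\<And>W. W \<in> partial_allocs E \<alpha> \<beta> \<Longrightarrow>
        \<Psi> W = (\<Sum>x\<in>UNIV. f x (\<lambda>y. W x y)) + (\<Sum>y\<in>UNIV. g y (\<lambda>x. W x y))"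
    and utilities: "\<And>a W W'. W \<in> partial_allocs E \<alpha> \<beta> \<Longrightarrow> W' \<in> partial_allocs E \<alpha> \<beta> \<Longrightarrow>
        (\<forall>x y. x \<noteq> a \<longrightarrow> W' x y = W x y) \<Longrightarrow> U a W' - U a W = \<Psi> W' - \<Psi> W"
    and "\<gamma> > 0"
    and "\<And>x. \<nu>on x \<ge> 0" "\<And>x. \<nu>off x \<ge> 0" "\<And>x. \<nu>act x \<ge> 0"
    and process: "ctmc M (partial_allocs E \<alpha> \<beta> \<times> UNIV)
        (alloc_rate \<gamma> U \<M> \<nu>on \<nu>off \<nu>act) X"
    and capacity: "\<And>D :: 'x set. (\<Sum>x\<in>D. \<alpha> x) \<le> (\<Sum>y\<in>E `` D. \<beta> y)"
    and active: "\<And>x. \<nu>on x > 0" "\<And>x. \<nu>act x > 0"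
    and admissible: "admissible_family E \<alpha> \<beta> \<M>"
  shows "\<P>(\<omega> in M. \<exists>t0\<ge>0. \<forall>t\<ge>t0. fst (X t \<omega>) \<in> allocs E \<alpha> \<beta>) = 1"
proof -
  let ?S = "partial_allocs E \<alpha> \<beta> \<times> (UNIV :: 'x func set)"
  let ?A = "allocs E \<alpha> \<beta> \<times> (UNIV :: 'x func set)"
  interpret ctmc M ?S "alloc_rate \<gamma> U \<M> \<nu>on \<nu>off \<nu>act" X by (rule process)
  have "AE \<omega> in M. \<exists>t0\<ge>0. \<forall>t\<ge>t0. X t \<omega> \<in> ?A"
  proof (rule AE_eventually_always_in_closed_set)
    show "?A \<subseteq> ?S" by (auto simp: allocs_def)
    fix i j assume ij: "i \<in> ?A" "j \<in> ?S - ?A"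
    obtain W \<xi> W' \<xi>' where [simp]: "i = (W, \<xi>)" "j = (W', \<xi>')" by (cases i; cases j)
    have "alloc_rate \<gamma> U \<M> \<nu>on \<nu>off \<nu>act (W, \<xi>) (W', \<xi>') = 0"
      by (rule rate_leaving_allocs[OF admissible]) (use ij in simp_all)
    then show "alloc_rate \<gamma> U \<M> \<nu>on \<nu>off \<nu>act i j = 0" by simp
  next
    fix i assume i: "i \<in> ?S"
    obtain W \<xi> where [simp]: "i = (W, \<xi>)" by (cases i)
    have "\<exists>W'\<in>allocs E \<alpha> \<beta>. ((W, \<xi>), (W', \<lambda>_. True)) \<in>
        {(i, j). i \<in> ?S \<and> j \<in> ?S \<and> alloc_rate \<gamma> U \<M> \<nu>on \<nu>off \<nu>act i j > 0}\<^sup>*"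
      by (rule steps_reach_allocs[OF admissible active capacity]) (use i in simp)
    then show "\<exists>j\<in>?A. (i, j) \<in> {(i, j). i \<in> ?S \<and> j \<in> ?S \<and> alloc_rate \<gamma> U \<M> \<nu>on \<nu>off \<nu>act i j > 0}\<^sup>*"
      unfolding \<open>i = (W, \<xi>)\<close> by (elim bexE, intro bexI[rotated]) simp_all
  qed
  then have "\<P>(\<omega> in M. \<exists>t0\<ge>0. \<forall>t\<ge>t0. X t \<omega> \<in> ?A) = 1"
    using prob_Collect_eq_1[OF eventually_always_in_events] by blast
  then show ?thesis by (simp add: mem_Times_iff)
qed

end
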